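(* Let $V\colon\mathbb{R}^n\to\mathbb{R}$ be the optimal value function of a networked optimal control problem (in continuous or discrete time, as described in the context) with $s$ subsystems and directed graph $\mathcal{G}$, and let $\Omega=[-a,a]^n$ with $a>0$. Assume that there exists a function $\gamma\in\mathcal{L}$ such that $$\big|\Psi_l^j(H_l^{j}x)-V(\Pi^{j-1}x)+V(\Pi^{j}x)\big|\le\gamma(l+1)\qquad\text{for all } l\in[s],\ j\in[s],\ x\in\mathbb{R}^n .$$ Then for all $l\in[s]$ and all $x\in\Omega$, $$\Big|V(x)-\sum_{j=1}^s\Psi_l^j(H_l^{j}x)-V(0)\Big|\le (s-1)\,\gamma(l+1).$$
   Context: Notation: $[j]:=\{1,\dots,j\}$ for $j\in\mathbb{N}$. $\mathcal{L}$ is the set of continuous, strictly decreasing functions $\gamma\colon\mathbb{R}_{\ge0}\to\mathbb{R}_{\ge0}$ with $\lim_{\tau\to\infty}\gamma(\tau)=0$. Optimal control problem: there are $s\in\mathbb{N}$ subsystems $\mathcal{V}=\{v_1,\dots,v_s\}$ and a directed graph $\mathcal{G}=(\mathcal{V},\mathcal{E})$, where $(i,j)\in\mathcal{E}$ means that $v_i$ influences $v_j$; $\mathcal{N}_j=\{i\mid(i,j)\in\mathcal{E}\}$. Subsystem $j$ has state $x_j\in\mathbb{R}^{n_j}$, control $u_j\in\mathbb{R}^{m_j}$, and cost $\ell_j$; $x=(x_1,\dots,x_s)\in\mathbb{R}^n$ and $u=(u_1,\dots,u_s)\in\mathbb{R}^m$ with $n=\sum_j n_j$, $m=\sum_j m_j$;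 $x_{\mathcal{N}_j},u_{\mathcal{N}_j}$ collect the states and controls with index in $\mathcal{N}_j$. Let $\delta\in[0,\infty)$ be a discount factor. The problem is to minimize $J(x_0,u)$ subject to the dynamics with $x(0)=x_0$, where either (continuous time) $$J(x_0,u)=\int_0^\infty e^{-\delta t}\sum_{j=1}^s\ell_j(x_j(t),u_j(t),x_{\mathcal{N}_j}(t),u_{\mathcal{N}_j}(t))\,dt,\quad \dot x_j(t)=f_j(x_j(t),u_j(t),x_{\mathcal{N}_j}(t),u_{\mathcal{N}_j}(t)),\ j\in[s],$$ or (discrete time) $$J(x_0,u)=\sum_{k=0}^\infty\Big(\tfrac{1}{1+\delta}\Big)^{k+1}\sum_{j=1}^s\ell_j(x_j(k),u_j(k),x_{\mathcal{N}_j}(k),u_{\mathcal{N}_j}(k)),\quad x_j(k+1)=f_j(x_j(k),u_j(k),x_{\mathcal{N}_j}(k),u_{\mathcal{N}_j}(k)),\ j\in[s].$$ The optimal value function is $V\colon\mathbb{R}^n\to\mathbb{R}$, $V(x)=\inf_u J(x,u)$; it is assumed to be well-defined and finite on $\Omega=[-a,a]^n$. Graph neighborhoods: $\operatorname{dist}_{\mathcal{G}}(i,j)$ is the length of the shortest (directed) path in $\mathcal{G}$ from $v_i$ to $v_j$, and $\mathcal{B}_l(j):=\{i\in[s]\mid\operatorname{dist}_{\mathcal{G}}(i,j)\le l\}$, with $b_l^j:=\sum_{i\in\mathcal{B}_l(j)}n_i$. In particular $j\in\mathcal{B}_l(j)$. Projections: writing $\mathcal{B}_l(j)=\{\beta_1,\dots,\beta_r\}$,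 the matrix $H_l^j\in\mathbb{R}^{b_l^j\times n}$ is defined blockwise by $H_l^j[k,i]=I_{n_i}$ if $\beta_k=i$ and $H_l^j[k,i]=0_{n_{\beta_k}\times n_i}$ otherwise ($k\in[r]$, $i\in[s]$); thus $H_l^jx$ extracts the substates with index in $\mathcal{B}_l(j)$ and $(H_l^j)^\top$ embeds $\mathbb{R}^{b_l^j}$ into $\mathbb{R}^n$ by filling in zeros. For $j\in\{0,\dots,s\}$, $\Pi^j:=\operatorname{diag}(0_{n_1},\dots,0_{n_j},I_{n_{j+1}},\dots,I_{n_s})\in\mathbb{R}^{n\times n}$, which sets the first $j$ substates to zero (so $\Pi^0=I_n$, $\Pi^s=0_n$). The functions $\Psi_l^j\colon\mathbb{R}^{b_l^j}\to\mathbb{R}$ are defined by $$\Psi_l^j(z):=V\big(\Pi^{j-1}(H_l^j)^\top z\big)-V\big(\Pi^{j}(H_l^j)^\top z\big).$$ *)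

theory Defs
  imports
    "HOL-Analysis.Set_Integral"
    "HOL-Analysis.Lebesgue_Measure"
    "Graph_Theory.Pair_Digraph"
    "HOL-Library.Extended_Nat"
    "Jordan_Normal_Form.Matrix"
begin

no_notation vec_nth (infixl \<open>$\<close> 90)

definition class_L :: "(real \<Rightarrow> real) set" where
  "class_L = {\<gamma>. continuous_on {0..} \<gamma> \<and> strict_antimono_on {0..} \<gamma> \<and>
                  (\<forall>\<tau>\<ge>0. 0 \<le> \<gamma> \<tau>) \<and> (\<gamma> \<longlongrightarrow> 0) at_top}"

text \<open>Subsystems are numbered \<open>1, \<dots>, subsystems P\<close>. An arc \<open>(i, j)\<close> of \<open>network P\<close> means that
  subsystem \<open>i\<close> influences subsystem \<open>j\<close>. The arguments of \<open>dynamics P j\<close> and \<open>stage_cost P j\<close>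
  are, in this order, \<open>x\<^sub>j\<close>, \<open>u\<^sub>j\<close>, and the stacked states and controls of the in-neighbours of \<open>j\<close>.\<close>

record networked_ocp =
  subsystems :: nat
  network :: "nat pair_pre_digraph"
  state_dim :: "nat \<Rightarrow> nat"
  ctrl_dim :: "nat \<Rightarrow> nat"
  dynamics :: "nat \<Rightarrow> real vec \<Rightarrow> real vec \<Rightarrow> real vec \<Rightarrow> real vec \<Rightarrow> real vec"
  stage_cost :: "nat \<Rightarrow> real vec \<Rightarrow> real vec \<Rightarrow> real vec \<Rightarrow> real vec \<Rightarrow> real"
  discount :: real

definition nbhd :: "networked_ocp \<Rightarrow> nat \<Rightarrow> nat set" where
  "nbhd P j = {i. (i, j) \<in> parcs (network P)}"

definition total_state_dim :: "networked_ocp \<Rightarrow> nat" where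
  "total_state_dim P = (\<Sum>j\<in>{1..subsystems P}. state_dim P j)"

definition total_ctrl_dim :: "networked_ocp \<Rightarrow> nat" where
  "total_ctrl_dim P = (\<Sum>j\<in>{1..subsystems P}. ctrl_dim P j)"

definition valid_ocp :: "networked_ocp \<Rightarrow> bool" where
  "valid_ocp P \<longleftrightarrow>
     1 \<le> subsystems P \<and>
     pair_wf_digraph (network P) \<and> pverts (network P) = {1..subsystems P} \<and>
     0 \<le> discount P \<and>
     (\<forall>j\<in>{1..subsystems P}.
        \<forall>x\<in>carrier_vec (state_dim P j). \<forall>u\<in>carrier_vec (ctrl_dim P j).
        \<forall>y\<in>carrier_vec (\<Sum>i\<in>nbhd P j. state_dim P i).
        \<forall>w\<in>carrier_vec (\<Sum>i\<in>nbhd P j. ctrl_dim P i).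
          dynamics P j x u y w \<in> carrier_vec (state_dim P j))"

text \<open>A vector with blocks of sizes \<open>d 1, d 2, \<dots>\<close> is stored contiguously; vector entries are
  indexed from \<open>0\<close>, blocks from \<open>1\<close>.\<close>

definition block :: "(nat \<Rightarrow> nat) \<Rightarrow> nat \<Rightarrow> real vec \<Rightarrow> real vec" where
  "block d i x = vec (d i) (\<lambda>p. x $ ((\<Sum>k\<in>{1..<i}. d k) + p))"

definition stack_blocks :: "(nat \<Rightarrow> nat) \<Rightarrow> nat set \<Rightarrow> real vec \<Rightarrow> real vec" where
  "stack_blocks d A x = foldr (\<lambda>i v. block d i x @\<^sub>v v) (sorted_list_of_set A) (0\<^sub>v 0)"

definition local_dynamics :: "networked_ocp \<Rightarrow> nat \<Rightarrow> real vec \<Rightarrow> real vec \<Rightarrow> real vec" where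
  "local_dynamics P j x u =
     dynamics P j (block (state_dim P) j x) (block (ctrl_dim P) j u)
       (stack_blocks (state_dim P) (nbhd P j) x) (stack_blocks (ctrl_dim P) (nbhd P j) u)"

definition running_cost :: "networked_ocp \<Rightarrow> real vec \<Rightarrow> real vec \<Rightarrow> real" where
  "running_cost P x u =
     (\<Sum>j\<in>{1..subsystems P}.
        stage_cost P j (block (state_dim P) j x) (block (ctrl_dim P) j u)
          (stack_blocks (state_dim P) (nbhd P j) x) (stack_blocks (ctrl_dim P) (nbhd P j) u))"

text \<open>The continuous-time dynamics are understood in the sense of Caratheodory: a trajectory is
  locally absolutely continuous and satisfies the differential equation almost everywhere,
  that is, it satisfies the integrated equation. For continuous right-hand sides along the
  trajectory this is the classical notion of solution.\<close>

definition ct_trajectory ::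
    "networked_ocp \<Rightarrow> real vec \<Rightarrow> (real \<Rightarrow> real vec) \<Rightarrow> (real \<Rightarrow> real vec) \<Rightarrow> bool" where
  "ct_trajectory P x0 u x \<longleftrightarrow>
     x 0 = x0 \<and> (\<forall>t\<ge>0. x t \<in> carrier_vec (total_state_dim P)) \<and>
     (\<forall>j\<in>{1..subsystems P}. \<forall>p<state_dim P j. \<forall>t\<ge>0.
        set_integrable lebesgue {0..t} (\<lambda>\<tau>. local_dynamics P j (x \<tau>) (u \<tau>) $ p) \<and>
        block (state_dim P) j (x t) $ p =
          block (state_dim P) j x0 $ p
            + (LINT \<tau>:{0..t}|lebesgue. local_dynamics P j (x \<tau>) (u \<tau>) $ p))"

text \<open>The integral over \<open>[0, \<infinity>)\<close> is the limit of the integrals over \<open>[0, T]\<close>, with \<open>\<plusminus>\<infinity>\<close>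
  admitted as values.\<close>

definition ct_cost :: "networked_ocp \<Rightarrow> (real \<Rightarrow> real vec) \<Rightarrow> (real \<Rightarrow> real vec) \<Rightarrow> ereal \<Rightarrow> bool" where
  "ct_cost P x u c \<longleftrightarrow>
     (\<forall>T\<ge>0. set_integrable lebesgue {0..T}
              (\<lambda>t. exp (- discount P * t) * running_cost P (x t) (u t))) \<and>
     ((\<lambda>T. ereal (LINT t:{0..T}|lebesgue. exp (- discount P * t) * running_cost P (x t) (u t)))
        \<longlongrightarrow> c) at_top"

text \<open>The argument \<open>U\<close> is the class of control functions (measurable, locally bounded, piecewise
  continuous, \<dots>) over which the infimum is taken. If the state equation has several solutions
  for one control, the infimum also ranges over these. Controls without a trajectory, or whose
  cost has no value in the extended reals, do not compete; an empty infimum is \<open>\<infinity>\<close>.\<close>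

definition ct_value :: "networked_ocp \<Rightarrow> (real \<Rightarrow> real vec) set \<Rightarrow> real vec \<Rightarrow> ereal" where
  "ct_value P U x0 =
     Inf {c. \<exists>u\<in>U. \<exists>x. (\<forall>t\<ge>0. u t \<in> carrier_vec (total_ctrl_dim P)) \<and>
                       ct_trajectory P x0 u x \<and> ct_cost P x u c}"

definition dt_trajectory ::
    "networked_ocp \<Rightarrow> real vec \<Rightarrow> (nat \<Rightarrow> real vec) \<Rightarrow> (nat \<Rightarrow> real vec) \<Rightarrow> bool" where
  "dt_trajectory P x0 u x \<longleftrightarrow>
     x 0 = x0 \<and> (\<forall>k. x k \<in> carrier_vec (total_state_dim P)) \<and>
     (\<forall>j\<in>{1..subsystems P}. \<forall>k.
        block (state_dim P) j (x (Suc k)) = local_dynamics P j (x k) (u k))"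

definition dt_cost :: "networked_ocp \<Rightarrow> (nat \<Rightarrow> real vec) \<Rightarrow> (nat \<Rightarrow> real vec) \<Rightarrow> ereal \<Rightarrow> bool" where
  "dt_cost P x u c \<longleftrightarrow>
     (\<lambda>K. ereal (\<Sum>k<K. (1 / (1 + discount P)) ^ (k + 1) * running_cost P (x k) (u k)))
       \<longlonglongrightarrow> c"

definition dt_value :: "networked_ocp \<Rightarrow> real vec \<Rightarrow> ereal" where
  "dt_value P x0 =
     Inf {c. \<exists>u x. (\<forall>k. u k \<in> carrier_vec (total_ctrl_dim P)) \<and>
                   dt_trajectory P x0 u x \<and> dt_cost P x u c}"

definition graph_dist :: "nat pair_pre_digraph \<Rightarrow> nat \<Rightarrow> nat \<Rightarrow> enat" where
  "graph_dist G i j = (INF p\<in>{p. pre_digraph.apath (with_proj G) i p j}. enat (length p))"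

definition graph_ball :: "networked_ocp \<Rightarrow> nat \<Rightarrow> nat \<Rightarrow> nat set" where
  "graph_ball P l j = {i \<in> {1..subsystems P}. graph_dist (network P) i j \<le> enat l}"

definition append_cols :: "real mat \<Rightarrow> real mat \<Rightarrow> real mat" where
  "append_cols A B = four_block_mat A B (0\<^sub>m 0 (dim_col A)) (0\<^sub>m 0 (dim_col B))"

definition block_row_H :: "networked_ocp \<Rightarrow> nat \<Rightarrow> real mat" where
  "block_row_H P b =
     foldr (\<lambda>i. append_cols (if b = i then 1\<^sub>m (state_dim P i)
                              else 0\<^sub>m (state_dim P b) (state_dim P i)))
       [1..<Suc (subsystems P)] (0\<^sub>m (state_dim P b) 0)"

text \<open>The block rows of \<open>H\<close> are listed in increasing order of the subsystem index.\<close>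

definition mat_H :: "networked_ocp \<Rightarrow> nat \<Rightarrow> nat \<Rightarrow> real mat" where
  "mat_H P l j =
     foldr (\<lambda>b M. block_row_H P b @\<^sub>r M) (sorted_list_of_set (graph_ball P l j))
       (0\<^sub>m 0 (total_state_dim P))"

definition mat_Pi :: "networked_ocp \<Rightarrow> nat \<Rightarrow> real mat" where
  "mat_Pi P j =
     diag_block_mat
       (map (\<lambda>i. if i \<le> j then 0\<^sub>m (state_dim P i) (state_dim P i) else 1\<^sub>m (state_dim P i))
         [1..<Suc (subsystems P)])"

definition Psi :: "networked_ocp \<Rightarrow> (real vec \<Rightarrow> real) \<Rightarrow> nat \<Rightarrow> nat \<Rightarrow> real vec \<Rightarrow> real" where
  "Psi P V l j z =
     V (mat_Pi P (j - 1) *\<^sub>v ((mat_H P l j)\<^sup>T *\<^sub>v z)) - V (mat_Pi P j *\<^sub>v ((mat_H P l j)\<^sup>T *\<^sub>v z))"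

definition cube :: "nat \<Rightarrow> real \<Rightarrow> real vec set" where
  "cube N a = {x \<in> carrier_vec N. \<forall>i<N. x $ i \<in> {-a..a}}"

end

theory Submission
  imports Defs
begin

text \<open>Since \<open>\<Pi>\<^sup>0 = I\<close> and \<open>\<Pi>\<^sup>s = 0\<close>, the differences \<open>V (\<Pi>\<^sup>j\<^sup>-\<^sup>1 x) - V (\<Pi>\<^sup>j x)\<close> telescope to
  \<open>V x - V 0\<close>, so the error is the sum over \<open>j\<close> of the local errors, each at most \<open>\<gamma> (l + 1)\<close>.
  The local error for \<open>j = s\<close> vanishes, which gives the factor \<open>s - 1\<close>: subsystem \<open>s\<close> lies in its
  own ball, so restricting to the ball keeps the last block, and \<open>\<Pi>\<^sup>s\<^sup>-\<^sup>1\<close> sees only that block.\<close>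

section \<open>Entrywise form of the block matrices\<close>

lemma sum_dim_Suc_le:
  fixes d :: "nat \<Rightarrow> nat"
  assumes "b < c" "1 \<le> b"
  shows "(\<Sum>k\<in>{1..<b}. d k) + d b \<le> (\<Sum>k\<in>{1..<c}. d k)"
proof -
  have "(\<Sum>k\<in>{1..<b}. d k) + d b = (\<Sum>k\<in>{1..<Suc b}. d k)"
    using assms by simp
  also have "\<dots> \<le> (\<Sum>k\<in>{1..<c}. d k)"
    using assms by (intro sum_mono2) auto
  finally show ?thesis .
qed

text \<open>The start index \<open>i\<close> is general because the induction peels off the first
  block and moves the start to \<open>Suc i\<close>. The guard \<open>i \<le> b\<close> matters:
  once the start has passed \<open>b\<close>, the offset sum is empty and would otherwise place a
  spurious identity block at column 0.\<close>

lemma foldr_append_cols_unit_blocks: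
  "foldr (\<lambda>i. append_cols (if b = i then 1\<^sub>m (d i) else 0\<^sub>m (d b) (d i))) [i..<i + k] (0\<^sub>m (d b) 0)
   = mat (d b) (\<Sum>t\<in>{i..<i + k}. d t)
       (\<lambda>(p, q). if i \<le> b \<and> b < i + k \<and> q = (\<Sum>t\<in>{i..<b}. d t) + p then 1 else 0)"
proof (induction k arbitrary: i)
  case 0
  show ?case by (intro eq_matI) auto
next
  case (Suc k)
  have list: "[i..<i + Suc k] = i # [Suc i..<Suc i + k]"
    by (simp add: upt_conv_Cons)
  have total: "(\<Sum>t\<in>{i..<Suc (i + k)}. d t) = d i + (\<Sum>t\<in>{Suc i..<Suc (i + k)}. d t)"
    by (simp add: sum.atLeast_Suc_lessThan)
  have offset: "(\<Sum>t\<in>{i..<b}. d t) = d i + (\<Sum>t\<in>{Suc i..<b}. d t)" if "i < b"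
    using that by (simp add: sum.atLeast_Suc_lessThan)
  \<comment> \<open>If \<open>b < i\<close>, head and tail are both zero; if \<open>b = i\<close>,
    the head is the identity and the guard kills the tail; if \<open>b > i\<close>, the head is zero
    and shifts the tail by \<open>d i\<close> columns.\<close>
  show ?case
    unfolding list foldr.simps o_def Suc.IH
    by (rule eq_matI, cases b i rule: linorder_cases)
      (auto simp: append_cols_def total offset simp del: sum.op_ivl_Suc)
qed

text \<open>Zero blocks precede identity blocks, so a single threshold on the row index describes
  the diagonal. For \<open>j < i\<close> the threshold is an empty sum, and every diagonal entry is
  1.\<close>

lemma diag_block_mat_threshold:
  "diag_block_mat (map (\<lambda>i. if i \<le> j then 0\<^sub>m (d i) (d i) else 1\<^sub>m (d i)) [i..<i + k])
   = mat (\<Sum>t\<in>{i..<i + k}. d t) (\<Sum>t\<in>{i..<i + k}. d t)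
       (\<lambda>(p, q). if p = q \<and> (\<Sum>t\<in>{i..<Suc j}. d t) \<le> p then (1 :: real) else 0)"
proof (induction k arbitrary: i)
  case 0
  show ?case by (intro eq_matI) auto
next
  case (Suc k)
  have list: "[i..<i + Suc k] = i # [Suc i..<Suc i + k]"
    by (simp add: upt_conv_Cons)
  have total: "(\<Sum>t\<in>{i..<Suc (i + k)}. d t) = d i + (\<Sum>t\<in>{Suc i..<Suc (i + k)}. d t)"
    by (simp add: sum.atLeast_Suc_lessThan)
  have offset: "(\<Sum>t\<in>{i..<Suc j}. d t) = d i + (\<Sum>t\<in>{Suc i..<Suc j}. d t)" if "i \<le> j"
    using that by (simp add: sum.atLeast_Suc_lessThan del: sum.op_ivl_Suc)
  have empty: "(\<Sum>t\<in>{i..<Suc j}. d t) = 0" "(\<Sum>t\<in>{Suc i..<Suc j}. d t) = 0" if "\<not> i \<le> j"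
    using that by auto
  show ?case
    unfolding list list.map diag_block_mat.simps Let_def Suc.IH
    by (rule eq_matI, cases "i \<le> j")
      (auto simp: total offset empty split: if_splits simp del: sum.op_ivl_Suc)
qed

lemma mat_Pi_mult_vec:
  assumes "x \<in> carrier_vec (total_state_dim P)"
  shows "mat_Pi P j *\<^sub>v x = vec (total_state_dim P)
    (\<lambda>p. if (\<Sum>t\<in>{1..<Suc j}. state_dim P t) \<le> p then x $ p else 0)"
proof -
  let ?n = "total_state_dim P" and ?o = "\<Sum>t\<in>{1..<Suc j}. state_dim P t"
  have "{1..<1 + subsystems P} = {1..subsystems P}" by auto
  then have Pi: "mat_Pi P j = mat ?n ?n (\<lambda>(p, q). if p = q \<and> ?o \<le> p then 1 else 0)"
    using diag_block_mat_threshold[of j "state_dim P" 1 "subsystems P"]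
    by (simp add: mat_Pi_def total_state_dim_def del: upt_Suc)
  show ?thesis
    unfolding Pi using assms
    by (intro eq_vecI)
      (auto simp: scalar_prod_def if_distrib[of "\<lambda>c. c * _"] sum.delta cong: if_cong
        simp del: sum.op_ivl_Suc)
qed

lemma mat_Pi_0_mult_vec:
  "x \<in> carrier_vec (total_state_dim P) \<Longrightarrow> mat_Pi P 0 *\<^sub>v x = x"
  by (auto simp: mat_Pi_mult_vec)

lemma mat_Pi_subsystems_mult_vec:
  "x \<in> carrier_vec (total_state_dim P) \<Longrightarrow>
    mat_Pi P (subsystems P) *\<^sub>v x = 0\<^sub>v (total_state_dim P)"
  by (subst mat_Pi_mult_vec)
    (auto simp: total_state_dim_def atLeastLessThanSuc_atLeastAtMost simp del: sum.op_ivl_Suc)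

lemma block_row_H_eq:
  assumes "b \<in> {1..subsystems P}"
  shows "block_row_H P b = mat (state_dim P b) (total_state_dim P)
    (\<lambda>(p, q). if q = (\<Sum>t\<in>{1..<b}. state_dim P t) + p then 1 else 0)"
proof -
  have "{1..<1 + subsystems P} = {1..subsystems P}" by auto
  then show ?thesis
    using assms foldr_append_cols_unit_blocks[of b "state_dim P" 1 "subsystems P"]
    by (simp add: block_row_H_def total_state_dim_def del: upt_Suc)
qed

text \<open>The block row cuts out block \<open>b\<close> and its transpose puts it back at the same
  offset \<open>r\<close>, so together they form a coordinate projection.\<close>

lemma transpose_block_row_H_mult:
  assumes b: "b \<in> {1..subsystems P}" and x: "x \<in> carrier_vec (total_state_dim P)"
    and q: "q < total_state_dim P"
  defines "r \<equiv> \<Sum>t\<in>{1..<b}. state_dim P t"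
  shows "((block_row_H P b)\<^sup>T *\<^sub>v (block_row_H P b *\<^sub>v x)) $ q
    = (if r \<le> q \<and> q < r + state_dim P b then x $ q else 0)"
proof -
  let ?n = "total_state_dim P" and ?d = "state_dim P b"
  \<comment> \<open>Keeps the unit entry of row \<open>p\<close>, in column \<open>r + p\<close>,
    inside the matrix.\<close>
  have le: "r + ?d \<le> ?n"
    using sum_dim_Suc_le[of b "Suc (subsystems P)" "state_dim P"] b
    by (simp add: r_def total_state_dim_def atLeastLessThanSuc_atLeastAtMost del: sum.op_ivl_Suc)
  have restrict: "block_row_H P b *\<^sub>v x = vec ?d (\<lambda>p. x $ (r + p))"
    unfolding block_row_H_eq[OF b] r_def[symmetric] using x le
    by (intro eq_vecI)
      (auto simp: scalar_prod_def if_distrib[of "\<lambda>c. c * _"] sum.delta cong: if_cong)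
  have "((block_row_H P b)\<^sup>T *\<^sub>v vec ?d (\<lambda>p. x $ (r + p))) $ q
      = (\<Sum>p\<in>{0..<?d}. if q = r + p then x $ (r + p) else 0)"
    unfolding block_row_H_eq[OF b] r_def[symmetric] using q
    by (auto simp: scalar_prod_def intro!: sum.cong)
  also have "\<dots> = (if r \<le> q \<and> q < r + ?d then x $ q else 0)"
  proof (cases "r \<le> q")
    case True
    then have "q = r + p \<longleftrightarrow> p = q - r" for p by auto
    with True show ?thesis by (auto simp: sum.delta cong: if_cong)
  qed (auto intro!: sum.neutral)
  finally show ?thesis by (simp add: restrict)
qed

section \<open>Restriction to a ball and re-embedding\<close>

lemma transpose_append_rows_mult:
  fixes A B :: "'a :: comm_semiring_0 mat"
  assumes A: "A \<in> carrier_mat m1 n" and B: "B \<in> carrier_mat m2 n"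
    and u: "u \<in> carrier_vec m1" and v: "v \<in> carrier_vec m2"
  shows "(A @\<^sub>r B)\<^sup>T *\<^sub>v (u @\<^sub>v v) = A\<^sup>T *\<^sub>v u + B\<^sup>T *\<^sub>v v"
proof (rule eq_vecI)
  fix q assume "q < dim_vec (A\<^sup>T *\<^sub>v u + B\<^sup>T *\<^sub>v v)"
  with B have q: "q < n" by auto
  have "col (A @\<^sub>r B) q = col A q @\<^sub>v col B q"
    using A B q by (intro eq_vecI) (auto simp: append_rows_def)
  moreover have "(col A q @\<^sub>v col B q) \<bullet> (u @\<^sub>v v) = col A q \<bullet> u + col B q \<bullet> v"
    using A B u v by (intro scalar_prod_append) auto
  ultimately show "((A @\<^sub>r B)\<^sup>T *\<^sub>v (u @\<^sub>v v)) $ q = (A\<^sup>T *\<^sub>v u + B\<^sup>T *\<^sub>v v) $ q"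
    using A B q by (auto simp: append_rows_def)
qed (use A B in \<open>auto simp: append_rows_def\<close>)

lemma foldr_append_rows_carrier:
  assumes "\<And>b. b \<in> set bs \<Longrightarrow> E b \<in> carrier_mat (d b) n"
  shows "foldr (\<lambda>b M. E b @\<^sub>r M) bs (0\<^sub>m 0 n) \<in> carrier_mat (\<Sum>b\<leftarrow>bs. d b) n"
  using assms by (induction bs) auto

text \<open>For stacked rows, the transpose times the matrix is the sum of the products of the
  pieces. This splits the restriction to a ball into projections onto single blocks.\<close>

lemma transpose_foldr_append_rows_mult:
  fixes E :: "'b \<Rightarrow> 'a :: comm_semiring_0 mat"
  assumes E: "\<And>b. b \<in> set bs \<Longrightarrow> E b \<in> carrier_mat (d b) n"
    and x: "x \<in> carrier_vec n" and q: "q < n"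
  defines "M \<equiv> foldr (\<lambda>b M. E b @\<^sub>r M) bs (0\<^sub>m 0 n)"
  shows "(M\<^sup>T *\<^sub>v (M *\<^sub>v x)) $ q = (\<Sum>b\<leftarrow>bs. ((E b)\<^sup>T *\<^sub>v (E b *\<^sub>v x)) $ q)"
  using E unfolding M_def
proof (induction bs)
  case Nil
  show ?case using q by (simp add: scalar_prod_def)
next
  case (Cons b bs)
  let ?M = "foldr (\<lambda>b M. E b @\<^sub>r M) bs (0\<^sub>m 0 n)"
  have Eb: "E b \<in> carrier_mat (d b) n" using Cons.prems by simp
  have M: "?M \<in> carrier_mat (\<Sum>b\<leftarrow>bs. d b) n"
    using Cons.prems by (intro foldr_append_rows_carrier) auto
  have "(E b @\<^sub>r ?M)\<^sup>T *\<^sub>v ((E b @\<^sub>r ?M) *\<^sub>v x)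
      = (E b)\<^sup>T *\<^sub>v (E b *\<^sub>v x) + ?M\<^sup>T *\<^sub>v (?M *\<^sub>v x)"
    unfolding mat_mult_append[OF Eb M x]
    by (rule transpose_append_rows_mult[OF Eb M]) (use Eb M x in auto)
  moreover have "(?M\<^sup>T *\<^sub>v (?M *\<^sub>v x)) $ q = (\<Sum>b\<leftarrow>bs. ((E b)\<^sup>T *\<^sub>v (E b *\<^sub>v x)) $ q)"
    using Cons by simp
  ultimately show ?case using M q by auto
qed

text \<open>The empty path at the vertex \<open>j\<close> has length 0, which is within any radius
  \<open>l\<close>.\<close>

lemma self_in_graph_ball:
  assumes "valid_ocp P" "j \<in> {1..subsystems P}"
  shows "j \<in> graph_ball P l j"
proof -
  have "pre_digraph.apath (with_proj (network P)) j [] j"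
    using assms by (simp add: pre_digraph.apath_def pre_digraph.awalk_def pre_digraph.cas.simps
        pre_digraph.awalk_verts.simps valid_ocp_def)
  then have "graph_dist (network P) j j \<le> enat (length ([] :: (nat \<times> nat) list))"
    unfolding graph_dist_def by (intro INF_lower) simp
  with assms show ?thesis
    by (auto simp: graph_ball_def intro: order_trans[of _ 0] simp flip: zero_enat_def)
qed

lemma mat_H_carrier:
  "mat_H P l j \<in> carrier_mat
    (\<Sum>b\<leftarrow>sorted_list_of_set (graph_ball P l j). state_dim P b) (total_state_dim P)"
  unfolding mat_H_def
  by (rule foldr_append_rows_carrier) (simp add: graph_ball_def block_row_H_eq)

text \<open>Of the block projections summed over the ball, only the one for the last subsystem
  reaches entry \<open>q\<close>, and it occurs because that subsystem lies in its own ball.\<close>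

lemma last_block_of_restriction:
  fixes l :: nat
  assumes "valid_ocp P" and x: "x \<in> carrier_vec (total_state_dim P)"
    and q: "q < total_state_dim P" "(\<Sum>t\<in>{1..<subsystems P}. state_dim P t) \<le> q"
  defines "H \<equiv> mat_H P l (subsystems P)"
  shows "(H\<^sup>T *\<^sub>v (H *\<^sub>v x)) $ q = x $ q"
proof -
  let ?s = "subsystems P" and ?B = "graph_ball P l (subsystems P)"
  have s: "1 \<le> ?s" using assms(1) by (simp add: valid_ocp_def)
  have "{1..?s} = {1..<Suc ?s}" by auto
  with s have total: "total_state_dim P = (\<Sum>t\<in>{1..<?s}. state_dim P t) + state_dim P ?s"
    by (simp add: total_state_dim_def)
  have sB: "?s \<in> ?B" using self_in_graph_ball[OF assms(1)] s by simp
  have B: "?B \<subseteq> {1..?s}" and fin: "finite ?B" by (auto simp: graph_ball_def)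
  have "(H\<^sup>T *\<^sub>v (H *\<^sub>v x)) $ q
      = (\<Sum>b\<leftarrow>sorted_list_of_set ?B. ((block_row_H P b)\<^sup>T *\<^sub>v (block_row_H P b *\<^sub>v x)) $ q)"
    unfolding H_def mat_H_def
    by (rule transpose_foldr_append_rows_mult[where d = "state_dim P"])
      (use x q B fin in \<open>auto simp: graph_ball_def block_row_H_eq\<close>)
  also have "\<dots> = (\<Sum>b\<in>?B. ((block_row_H P b)\<^sup>T *\<^sub>v (block_row_H P b *\<^sub>v x)) $ q)"
    using fin by (simp add: sum_list_distinct_conv_sum_set)
  also have "\<dots> = (\<Sum>b\<in>?B. if b = ?s then x $ q else 0)"
  proof (rule sum.cong[OF refl])
    fix b assume "b \<in> ?B"
    with B have b: "b \<in> {1..?s}" by auto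
    \<comment> \<open>A block with \<open>b < ?s\<close> ends no later than the last block starts,
      hence before \<open>q\<close>.\<close>
    show "((block_row_H P b)\<^sup>T *\<^sub>v (block_row_H P b *\<^sub>v x)) $ q = (if b = ?s then x $ q else 0)"
      unfolding transpose_block_row_H_mult[OF b x q(1)]
      using b q total sum_dim_Suc_le[of b ?s "state_dim P"] by (cases "b = ?s") auto
  qed
  also have "\<dots> = x $ q" using sB fin by simp
  finally show ?thesis .
qed

section \<open>Local errors and their sum\<close>

lemma Psi_last_exact:
  assumes "valid_ocp P" and x: "x \<in> carrier_vec (total_state_dim P)"
  defines "s \<equiv> subsystems P"
  shows "Psi P V l s (mat_H P l s *\<^sub>v x) = V (mat_Pi P (s - 1) *\<^sub>v x) - V (mat_Pi P s *\<^sub>v x)"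
proof -
  define w where "w = (mat_H P l s)\<^sup>T *\<^sub>v (mat_H P l s *\<^sub>v x)"
  have w: "w \<in> carrier_vec (total_state_dim P)"
    unfolding w_def by (rule carrier_vecI)
      (simp only: dim_mult_mat_vec index_transpose_mat carrier_matD(2)[OF mat_H_carrier])
  have "1 \<le> s" using assms(1) by (simp add: valid_ocp_def s_def)
  \<comment> \<open>The threshold of \<open>mat_Pi P (s - 1)\<close> is the start of the last block;
    \<open>1 \<le> s\<close> makes the truncated subtraction exact.\<close>
  then have offset: "(\<Sum>t\<in>{1..<Suc (s - 1)}. d t) = (\<Sum>t\<in>{1..<s}. d t)" for d :: "nat \<Rightarrow> nat"
    by (simp del: sum.op_ivl_Suc)
  have agree: "w $ q = x $ q"
    if "q < total_state_dim P" "(\<Sum>t\<in>{1..<s}. state_dim P t) \<le> q" for q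
    using last_block_of_restriction[OF assms(1) x] that unfolding w_def s_def by blast
  have "mat_Pi P (s - 1) *\<^sub>v w = mat_Pi P (s - 1) *\<^sub>v x"
    unfolding mat_Pi_mult_vec[OF w] mat_Pi_mult_vec[OF x] offset
    by (rule eq_vecI) (simp_all add: agree del: sum.op_ivl_Suc)
  moreover have "mat_Pi P s *\<^sub>v w = mat_Pi P s *\<^sub>v x"
    using w x by (simp add: s_def mat_Pi_subsystems_mult_vec)
  ultimately show ?thesis by (simp add: Psi_def w_def)
qed

theorem theorem4:
  fixes P :: networked_ocp
    and U :: "(real \<Rightarrow> real vec) set"
    and V_ext :: "real vec \<Rightarrow> ereal"
    and V :: "real vec \<Rightarrow> real"
    and a :: real
    and \<gamma> :: "real \<Rightarrow> real"
  assumes "valid_ocp P"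
    and "V_ext = ct_value P U \<or> V_ext = dt_value P"
    and "\<forall>x\<in>cube (total_state_dim P) a. \<bar>V_ext x\<bar> \<noteq> \<infinity>"
    and "V = (\<lambda>x. real_of_ereal (V_ext x))"
    and "0 < a"
    and "\<gamma> \<in> class_L"
    and "\<forall>l\<in>{1..subsystems P}. \<forall>j\<in>{1..subsystems P}. \<forall>x\<in>carrier_vec (total_state_dim P).
           \<bar>Psi P V l j (mat_H P l j *\<^sub>v x) - V (mat_Pi P (j - 1) *\<^sub>v x) + V (mat_Pi P j *\<^sub>v x)\<bar>
             \<le> \<gamma> (real (l + 1))"
  shows "\<forall>l\<in>{1..subsystems P}. \<forall>x\<in>cube (total_state_dim P) a.
           \<bar>V x - (\<Sum>j\<in>{1..subsystems P}. Psi P V l j (mat_H P l j *\<^sub>v x))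
              - V (0\<^sub>v (total_state_dim P))\<bar>
             \<le> (real (subsystems P) - 1) * \<gamma> (real (l + 1))"
proof (intro ballI)
  fix l x
  assume l: "l \<in> {1..subsystems P}" and "x \<in> cube (total_state_dim P) a"
  then have x: "x \<in> carrier_vec (total_state_dim P)" by (simp add: cube_def)
  define s where "s = subsystems P"
  \<comment> \<open>Interpolates between \<open>W 0 = V x\<close> and \<open>W s\<close>, the value
    of \<open>V\<close> at the origin.\<close>
  define W where "W j = V (mat_Pi P j *\<^sub>v x)" for j
  \<comment> \<open>The signed local error that the assumption on \<open>\<gamma>\<close>
    bounds.\<close>
  define D where "D j = Psi P V l j (mat_H P l j *\<^sub>v x) - W (j - 1) + W j" for j
  have s: "1 \<le> s" using assms(1) by (simp add: valid_ocp_def s_def)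
  have "(\<Sum>j\<in>{1..s}. W (j - 1) - W j) = W 0 - W s"
    by (induction s) auto
  moreover have "(\<Sum>j\<in>{1..s}. Psi P V l j (mat_H P l j *\<^sub>v x))
      = (\<Sum>j\<in>{1..s}. D j) + (\<Sum>j\<in>{1..s}. W (j - 1) - W j)"
    unfolding sum.distrib[symmetric] by (simp add: D_def)
  moreover have "D s = 0"
    using Psi_last_exact[OF assms(1) x, of V l] by (simp add: D_def W_def s_def)
  \<comment> \<open>Splits off the vanishing error \<open>D s\<close>, leaving \<open>s - 1\<close>
    terms for the triangle inequality.\<close>
  moreover have "{1..s} = insert s {1..<s}" using s by auto
  ultimately have "V x - (\<Sum>j\<in>{1..s}. Psi P V l j (mat_H P l j *\<^sub>v x)) - V (0\<^sub>v (total_state_dim P))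
      = - (\<Sum>j\<in>{1..<s}. D j)"
    using x by (simp add: W_def s_def mat_Pi_0_mult_vec mat_Pi_subsystems_mult_vec)
  moreover have "\<bar>\<Sum>j\<in>{1..<s}. D j\<bar> \<le> (\<Sum>j\<in>{1..<s}. \<gamma> (real (l + 1)))"
    using assms(7) l x by (intro order_trans[OF sum_abs] sum_mono) (auto simp: D_def W_def s_def)
  ultimately show "\<bar>V x - (\<Sum>j\<in>{1..subsystems P}. Psi P V l j (mat_H P l j *\<^sub>v x))
      - V (0\<^sub>v (total_state_dim P))\<bar> \<le> (real (subsystems P) - 1) * \<gamma> (real (l + 1))"
    using s by (simp add: s_def of_nat_diff)
qed

end
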